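(* Let $m\geq 1$ be an integer and let $x:\mathcal{L}\to\hat{\mathbb{C}}$ satisfy the dSKP recurrence. For $(i,j)\in\mathbb{Z}^2$ put $a_{i,j}=x(i,j,[i+j]_2)$. Suppose that there is $d\in\hat{\mathbb{C}}$ with $a_{i,j}=d$ for all $(i,j)$ with $i+j$ even, and that for all $(i,j)$ with $i+j$ odd, $a_{i,j}=a_{i+m,j+m}=a_{i+m,j-m}$ ("$m$-Dodgson initial data"). Then $x(i,j,m)$ is independent of $(i,j)$, as $(i,j)$ ranges over all pairs in $\mathbb{Z}^2$ with $(i,j,m)\in\mathcal{L}$.
   Context: $\hat{\mathbb{C}}=\mathbb{C}\cup\{\infty\}$ with the usual arithmetic conventions. $\mathcal{L}=\{(i,j,k)\in\mathbb{Z}^3: i+j+k\in 2\mathbb{Z}\}$ and $(e_1,e_2,e_3)$ is the canonical basis of $\mathbb{Z}^3$. A function $x:\mathcal{L}\to\hat{\mathbb{C}}$ satisfies the dSKP recurrence if for every $p\in\mathbb{Z}^3\setminus\mathcal{L}$, writing $x_q=x(p+q)$ for $q\in\{\pm e_1,\pm e_2,\pm e_3\}$, $$\frac{(x_{-e_3}-x_{e_2})(x_{-e_1}-x_{e_3})(x_{-e_2}-x_{e_1})}{(x_{e_2}-x_{-e_1})(x_{e_3}-x_{-e_2})(x_{e_1}-x_{-e_3})}=-1.$$ For $n\in\mathbb{Z}$ and $r\geq1$, $[n]_r\in\{0,\dots,r-1\}$ denotes the residue of $n$ modulo $r$.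
   Formalization: The recurrence is read with its denominator cleared (the quotient is 0/0 at height 0), and it is additionally assumed that at every p of height 1,…,m−1 it determines x(p+e_3) uniquely from the other five values; without this the claim fails, e.g. m=2 with odd data constant c≠d. *)

theory Defs
  imports Complex_Main "HOL-Library.Product_Plus"
begin

datatype riemann_sphere = Fin complex | Infty

text \<open>
  A point of the sphere is represented by homogeneous coordinates, \<open>[z : 1]\<close> for a finite
  \<open>z\<close> and \<open>[1 : 0]\<close> for infinity. The difference \<open>u - v\<close> is represented by the determinant
  of the coordinates: it is \<open>z - w\<close> for finite \<open>z\<close>, \<open>w\<close>, while \<open>\<infinity> - w\<close> and \<open>z - \<infinity>\<close> become
  \<open>1\<close> and \<open>-1\<close>.
\<close>

fun hnum :: "riemann_sphere \<Rightarrow> complex" where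
  "hnum (Fin z) = z"
| "hnum Infty = 1"

fun hden :: "riemann_sphere \<Rightarrow> complex" where
  "hden (Fin z) = 1"
| "hden Infty = 0"

definition hdiff :: "riemann_sphere \<Rightarrow> riemann_sphere \<Rightarrow> complex" where
  "hdiff u v = hnum u * hden v - hnum v * hden u"

lemma hdiff_simps [simp]:
  "hdiff (Fin z) (Fin w) = z - w"
  "hdiff Infty (Fin w) = 1"
  "hdiff (Fin z) Infty = -1"
  "hdiff Infty Infty = 0"
  by (simp_all add: hdiff_def)

lemma hdiff_eq_0_iff: "hdiff u v = 0 \<longleftrightarrow> u = v"
  by (cases u; cases v) auto

type_synonym point = "int \<times> int \<times> int"

definition lattice :: "point set" where
  "lattice = {(i, j, k). even (i + j + k)}"

definition e1 :: point where "e1 = (1, 0, 0)"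
definition e2 :: point where "e2 = (0, 1, 0)"
definition e3 :: point where "e3 = (0, 0, 1)"

text \<open>
  Functions on the lattice are represented by functions on all of \<open>point\<close>; only their values on
  the lattice are ever used (for \<open>p\<close> outside the lattice the six neighbours lie in it).
\<close>

definition skp_num :: "(point \<Rightarrow> riemann_sphere) \<Rightarrow> point \<Rightarrow> complex" where
  "skp_num x p = hdiff (x (p - e3)) (x (p + e2)) * hdiff (x (p - e1)) (x (p + e3))
                 * hdiff (x (p - e2)) (x (p + e1))"

definition skp_den :: "(point \<Rightarrow> riemann_sphere) \<Rightarrow> point \<Rightarrow> complex" where
  "skp_den x p = hdiff (x (p + e2)) (x (p - e1)) * hdiff (x (p + e3)) (x (p - e2))
                 * hdiff (x (p + e1)) (x (p - e3))"

text \<open>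
  The relation "\<open>skp_num / skp_den = -1\<close>" with the denominator cleared. Each of the six values
  occurs exactly once in \<open>skp_num\<close> and once in \<open>skp_den\<close>, so the relation does not depend on
  the choice of homogeneous coordinates; in particular a factor \<open>\<infinity>\<close> cancels in the quotient.
  Clearing the denominator matters: if the initial values \<open>x (i, j, 0)\<close> are all equal, the
  quotient is \<open>0 / 0\<close> at every \<open>p\<close> of height \<open>0\<close>, where the relation below is satisfied.
\<close>

definition dSKP_at :: "(point \<Rightarrow> riemann_sphere) \<Rightarrow> point \<Rightarrow> bool" where
  "dSKP_at x p \<longleftrightarrow> skp_num x p = - skp_den x p"

definition dSKP :: "(point \<Rightarrow> riemann_sphere) \<Rightarrow> bool" where
  "dSKP x \<longleftrightarrow> (\<forall>p. p \<notin> lattice \<longrightarrow> dSKP_at x p)"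

lemma dSKP_at_quotient:
  assumes "skp_den x p \<noteq> 0"
  shows "dSKP_at x p \<longleftrightarrow> skp_num x p / skp_den x p = -1"
  using assms by (simp add: dSKP_at_def divide_eq_eq)

lemma dSKP_at_quotient_finite:
  assumes "x (p + e1) = Fin a1" "x (p - e1) = Fin b1"
    and "x (p + e2) = Fin a2" "x (p - e2) = Fin b2"
    and "x (p + e3) = Fin a3" "x (p - e3) = Fin b3"
    and "(a2 - b1) * (a3 - b2) * (a1 - b3) \<noteq> 0"
  shows "dSKP_at x p \<longleftrightarrow>
    ((b3 - a2) * (b1 - a3) * (b2 - a1)) / ((a2 - b1) * (a3 - b2) * (a1 - b3)) = -1"
  using assms dSKP_at_quotient[of x p] by (simp add: skp_num_def skp_den_def)

text \<open>
  The relation at \<open>p\<close> can be solved uniquely, within the sphere, for the topmost value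
  \<open>x (p + e3)\<close>, the other five values being given. For special values this fails although the
  quotient is well defined: if \<open>x (p + e1) = x (p + e2)\<close> and \<open>x (p - e1) = x (p - e2)\<close>, every
  value at \<open>p + e3\<close> solves the relation.
\<close>

definition determines_top :: "(point \<Rightarrow> riemann_sphere) \<Rightarrow> point \<Rightarrow> bool" where
  "determines_top x p \<longleftrightarrow> (\<exists>!y. dSKP_at (x(p + e3 := y)) p)"

text \<open>
  The initial data at heights \<open>0\<close> and \<open>1\<close> propagate by the recurrence up to height \<open>m\<close>, i.e.
  each value at a height \<open>2, \<dots>, m\<close> is determined by values at the two preceding heights.
\<close>

definition propagates_up_to :: "int \<Rightarrow> (point \<Rightarrow> riemann_sphere) \<Rightarrow> bool" where
  "propagates_up_to m x \<longleftrightarrow>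
     (\<forall>i j k. (i, j, k) \<notin> lattice \<longrightarrow> 1 \<le> k \<longrightarrow> k < m \<longrightarrow> determines_top x (i, j, k))"

definition initial_data :: "(point \<Rightarrow> riemann_sphere) \<Rightarrow> int \<Rightarrow> int \<Rightarrow> riemann_sphere" where
  "initial_data x i j = x (i, j, (i + j) mod 2)"

definition Dodgson :: "int \<Rightarrow> (int \<Rightarrow> int \<Rightarrow> riemann_sphere) \<Rightarrow> bool" where
  "Dodgson m a \<longleftrightarrow>
     (\<exists>d. \<forall>i j. even (i + j) \<longrightarrow> a i j = d) \<and>
     (\<forall>i j. odd (i + j) \<longrightarrow> a i j = a (i + m) (j + m) \<and> a i j = a (i + m) (j - m))"

end

theory Submission
  imports "Jordan_Normal_Form.Char_Poly" Defs
begin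

text \<open>
  Choose homogeneous coordinates in which \<open>d\<close> is \<open>[1 : 0]\<close>, and arrange the values at height 1 in a
  matrix \<open>A\<close> whose rows and columns run along the two diagonals of the plane. Then the value at a
  site of height \<open>n\<close> is \<open>[D : S]\<close>, where \<open>D + t S\<close> is the determinant of an \<open>n \<times> n\<close> block of the
  matrix \<open>A + t\<close>: by Dodgson condensation these affine polynomials satisfy
  \<open>z b = p q - s t\<close>, where \<open>z\<close> belongs to a block, \<open>b\<close> to its interior and \<open>p, q, s, t\<close> to its four
  corners, and this implies the dSKP relation between their roots. For \<open>m\<close>-Dodgson data \<open>A\<close> is
  \<open>m\<close>-periodic in rows and columns, so that shifting an \<open>m \<times> m\<close> block permutes its rows or columns
  cyclically; \<open>D\<close> and \<open>S\<close> change by a common sign only.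

  Values equal to \<open>d\<close> at height 1 give infinite entries of \<open>A\<close>. They are replaced by a parameter
  \<open>N\<close> tending to infinity; since the recurrence determines each value uniquely, the solution is
  the projective limit of the perturbed ones.
\<close>

subsection \<open>Dodgson condensation\<close>

text \<open>Size 0 is allowed and has determinant 1, which accounts for the sites of height
  0.\<close>

definition window :: "(int \<Rightarrow> int \<Rightarrow> 'a) \<Rightarrow> int \<Rightarrow> int \<Rightarrow> nat \<Rightarrow> 'a mat" where
  "window A r c n = mat n n (\<lambda>(i, j). A (r + int i) (c + int j))"

lemma window_carrier [simp]: "window A r c n \<in> carrier_mat n n"
  by (simp add: window_def)

lemma dim_window [simp]: "dim_row (window A r c n) = n" "dim_col (window A r c n) = n"
  by (simp_all add: window_def)

lemma window_index [simp]:
  "i < n \<Longrightarrow> j < n \<Longrightarrow> window A r c n $$ (i, j) = A (r + int i) (c + int j)"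
  by (simp add: window_def)

lemma window_cong:
  assumes "\<And>i j. i < n \<Longrightarrow> j < n \<Longrightarrow> A (r + int i) (c + int j) = B (r' + int i) (c' + int j)"
  shows "window A r c n = window B r' c' n"
  using assms by (intro eq_matI) auto

lemma mat_delete_window:
  "mat_delete (window A r c (Suc n)) 0 0 = window A (r + 1) (c + 1) n"
  "mat_delete (window A r c (Suc n)) n n = window A r c n"
  "mat_delete (window A r c (Suc n)) 0 n = window A (r + 1) c n"
  "mat_delete (window A r c (Suc n)) n 0 = window A r (c + 1) n"
  by (intro eq_matI; simp add: mat_delete_def algebra_simps)+

lemma det_first_column:
  fixes A :: "int \<Rightarrow> int \<Rightarrow> 'a :: comm_ring_1"
  assumes "\<And>i. 0 < i \<Longrightarrow> i \<le> n \<Longrightarrow> A (r + int i) c = 0"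
  shows "det (window A r c (Suc n)) = A r c * det (window A (r + 1) (c + 1) n)"
proof -
  have "det (window A r c (Suc n)) =
      (\<Sum>i<Suc n. window A r c (Suc n) $$ (i, 0) * cofactor (window A r c (Suc n)) i 0)"
    by (rule laplace_expansion_column) auto
  also have "\<dots> = (\<Sum>i\<in>{0}. window A r c (Suc n) $$ (i, 0) * cofactor (window A r c (Suc n)) i 0)"
    using assms by (intro sum.mono_neutral_right) auto
  finally show ?thesis by (simp add: cofactor_def mat_delete_window)
qed

lemma det_last_column:
  fixes A :: "int \<Rightarrow> int \<Rightarrow> 'a :: comm_ring_1"
  assumes "\<And>i. i < n \<Longrightarrow> A (r + int i) (c + int n) = 0"
  shows "det (window A r c (Suc n)) = A (r + int n) (c + int n) * det (window A r c n)"
proof -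
  have "det (window A r c (Suc n)) =
      (\<Sum>i<Suc n. window A r c (Suc n) $$ (i, n) * cofactor (window A r c (Suc n)) i n)"
    by (rule laplace_expansion_column) auto
  also have "\<dots> = (\<Sum>i\<in>{n}. window A r c (Suc n) $$ (i, n) * cofactor (window A r c (Suc n)) i n)"
    using assms by (intro sum.mono_neutral_right) auto
  finally show ?thesis by (simp add: cofactor_def mat_delete_window)
qed

lemma det_two:
  fixes M :: "'a :: comm_ring_1 mat"
  assumes "M \<in> carrier_mat 2 2"
  shows "det M = M $$ (0, 0) * M $$ (1, 1) - M $$ (0, 1) * M $$ (1, 0)"
proof -
  have s: "det (mat_delete M i j) = mat_delete M i j $$ (0, 0)" for i j
    using mat_delete_carrier[OF assms] by (intro det_single) simp
  have "det M = (\<Sum>j<2. M $$ (0, j) * cofactor M 0 j)"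
    using assms by (intro laplace_expansion_row) auto
  also have "\<dots> = M $$ (0, 0) * M $$ (1, 1) - M $$ (0, 1) * M $$ (1, 0)"
    using assms by (simp add: numeral_2_eq_2 cofactor_def s) (simp add: mat_delete_def)
  finally show ?thesis .
qed

text \<open>Expanding along an inner column removes one unit vector and keeps the four corner
  entries, down to a 2 by 2 determinant.\<close>

lemma det_inner_unit_columns:
  fixes M :: "'a :: comm_ring_1 mat"
  assumes "M \<in> carrier_mat (n + 2) (n + 2)"
    and "\<And>i j. i < n + 2 \<Longrightarrow> 0 < j \<Longrightarrow> j \<le> n \<Longrightarrow> M $$ (i, j) = (if i = j then 1 else 0)"
  shows "det M = M $$ (0, 0) * M $$ (n + 1, n + 1) - M $$ (0, n + 1) * M $$ (n + 1, 0)"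
  using assms
proof (induction n arbitrary: M)
  case 0
  then show ?case using det_two[of M] by (simp add: numeral_2_eq_2)
next
  case (Suc n)
  have "det M = (\<Sum>i<Suc n + 2. M $$ (i, 1) * cofactor M i 1)"
    using Suc.prems by (intro laplace_expansion_column) auto
  also have "\<dots> = (\<Sum>i\<in>{1}. M $$ (i, 1) * cofactor M i 1)"
    using Suc.prems(2) by (intro sum.mono_neutral_right) auto
  also have "\<dots> = det (mat_delete M 1 1)"
    using Suc.prems(2)[of 1 1] by (simp add: cofactor_def)
  also have "\<dots> = mat_delete M 1 1 $$ (0, 0) * mat_delete M 1 1 $$ (n + 1, n + 1)
      - mat_delete M 1 1 $$ (0, n + 1) * mat_delete M 1 1 $$ (n + 1, 0)"
  proof (rule Suc.IH)
    show "mat_delete M 1 1 \<in> carrier_mat (n + 2) (n + 2)"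
      using mat_delete_carrier[OF Suc.prems(1), of 1 1] by simp
    show "mat_delete M 1 1 $$ (i, j) = (if i = j then 1 else 0)"
      if "i < n + 2" "0 < j" "j \<le> n" for i j
      using that Suc.prems by (auto simp: mat_delete_def)
  qed
  finally show ?case using Suc.prems(1) by (simp add: mat_delete_def)
qed

text \<open>
  Multiplying by \<open>N\<close>, the identity matrix with first and last column taken from the adjugate, turns
  the first and last column of the matrix into multiples of unit vectors.
\<close>

lemma condensation_nonsingular:
  fixes A :: "int \<Rightarrow> int \<Rightarrow> 'a :: idom"
  assumes "det (window A r c (n + 2)) \<noteq> 0"
  shows "det (window A r c (n + 2)) * det (window A (r + 1) (c + 1) n) =
    det (window A r c (n + 1)) * det (window A (r + 1) (c + 1) (n + 1))
    - det (window A (r + 1) c (n + 1)) * det (window A r (c + 1) (n + 1))"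
proof -
  define M where "M = window A r c (n + 2)"
  define B where "B = adj_mat M"
  define N where "N = mat (n + 2) (n + 2) (\<lambda>(i, j). if j = 0 \<or> j = n + 1 then B $$ (i, j)
    else if i = j then 1 else 0)"
  define P where "P = (\<lambda>i j. if j = c \<or> j = c + int n + 1
    then (if i - r = j - c then det M else 0) else A i j)"
  have M: "M \<in> carrier_mat (n + 2) (n + 2)" by (simp add: M_def)
  have B: "B \<in> carrier_mat (n + 2) (n + 2)" "M * B = det M \<cdot>\<^sub>m 1\<^sub>m (n + 2)"
    using adj_mat[OF M] by (simp_all add: B_def)
  have N: "N \<in> carrier_mat (n + 2) (n + 2)" by (simp add: N_def)
  have MN: "M * N = window P r c (n + 2)"
  proof (intro eq_matI)
    fix i j assume "i < dim_row (window P r c (n + 2))" "j < dim_col (window P r c (n + 2))"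
    then have ij: "i < n + 2" "j < n + 2" by simp_all
    show "(M * N) $$ (i, j) = window P r c (n + 2) $$ (i, j)"
    proof (cases "j = 0 \<or> j = n + 1")
      case True
      then have "col N j = col B j" using ij B(1) by (intro eq_vecI) (auto simp: N_def)
      then have "(M * N) $$ (i, j) = (M * B) $$ (i, j)" using ij M N B(1) by simp
      also have "\<dots> = window P r c (n + 2) $$ (i, j)"
        using ij True unfolding B(2) by (auto simp: P_def)
      finally show ?thesis .
    next
      case False
      then have "col N j = unit_vec (n + 2) j"
        using ij by (intro eq_vecI) (auto simp: N_def unit_vec_def)
      then have "(M * N) $$ (i, j) = M $$ (i, j)"
        using ij M N scalar_prod_right_unit[OF ij(2), of "row M i"] by simp
      then show ?thesis using ij False by (auto simp: P_def M_def)
    qed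
  qed (use M N in auto)
  have "det M * det N = det (window P r c (Suc (n + 1)))"
    using MN det_mult[OF M N] by simp
  also have "\<dots> = P r c * det (window P (r + 1) (c + 1) (Suc n))"
    by (subst det_first_column) (auto simp: P_def)
  also have "\<dots> = det M * (det M * det (window P (r + 1) (c + 1) n))"
    by (subst det_last_column) (auto simp: P_def)
  also have "window P (r + 1) (c + 1) n = window A (r + 1) (c + 1) n"
    by (rule window_cong) (auto simp: P_def)
  finally have "det N = det M * det (window A (r + 1) (c + 1) n)"
    using assms by (simp add: M_def)
  moreover have "det N = B $$ (0, 0) * B $$ (n + 1, n + 1) - B $$ (0, n + 1) * B $$ (n + 1, 0)"
    by (subst det_inner_unit_columns[OF N]) (auto simp: N_def)
  moreover have "B $$ (i, j) = cofactor M j i" if "i < n + 2" "j < n + 2" for i j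
    using that M by (simp add: B_def adj_mat_def)
  \<comment> \<open>The two mixed corner cofactors carry the same sign, which cancels in their
    product.\<close>
  moreover have "(-1 :: 'a) ^ n * ((-1) ^ n * a) = a" for a
    by (simp add: mult.assoc[symmetric] power_add[symmetric])
  ultimately show ?thesis
    using mat_delete_window[of A r c "n + 1"]
    by (simp add: M_def cofactor_def algebra_simps)
qed

lemma det_window_hom:
  fixes A :: "int \<Rightarrow> int \<Rightarrow> 'a :: comm_ring_1 poly"
  shows "det (window (\<lambda>i j. poly (A i j) x) r c n) = poly (det (window A r c n)) x"
proof -
  have "window (\<lambda>i j. poly (A i j) x) r c n = map_mat (\<lambda>p. poly p x) (window A r c n)"
    by (rule eq_matI) auto
  then show ?thesis by (simp only: comm_ring_hom.hom_det[OF poly_hom.comm_ring_hom_axioms])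
qed

text \<open>Adding an indeterminate on the diagonal makes the matrix nonsingular.\<close>

theorem Dodgson_condensation:
  fixes A :: "int \<Rightarrow> int \<Rightarrow> 'a :: idom"
  shows "det (window A r c (n + 2)) * det (window A (r + 1) (c + 1) n) =
    det (window A r c (n + 1)) * det (window A (r + 1) (c + 1) (n + 1))
    - det (window A (r + 1) c (n + 1)) * det (window A r (c + 1) (n + 1))"
proof -
  define A' where "A' = (\<lambda>i j. [:A i j, if i - r = j - c then 1 else 0:])"
  \<comment> \<open>The sign turns \<open>char_poly_matrix M\<close> into the block of
    \<open>A\<close> plus the indeterminate on its diagonal. Its determinant is monic; evaluation at
    0 recovers \<open>A\<close>.\<close>
  define M where "M = window (\<lambda>i j. - A i j) r c (n + 2)"
  have "window A' r c (n + 2) = char_poly_matrix M"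
    by (rule eq_matI) (auto simp: M_def A'_def char_poly_matrix_def)
  then have "det (window A' r c (n + 2)) = char_poly M"
    by (simp add: char_poly_def)
  moreover have "char_poly M \<noteq> 0"
    using degree_monic_char_poly[of M "n + 2"] by (auto simp: M_def)
  ultimately have "det (window A' r c (n + 2)) \<noteq> 0" by simp
  from arg_cong[OF condensation_nonsingular[OF this], of "\<lambda>p. poly p 0"]
  show ?thesis by (simp add: det_window_hom[symmetric]) (simp add: A'_def)
qed

subsection \<open>The dSKP relation for linear forms\<close>

text \<open>The homogeneous form of a difference: for nonzero vectors over a field it vanishes iff
  they represent the same projective point.\<close>

definition br :: "'a :: comm_ring_1 \<times> 'a \<Rightarrow> 'a \<times> 'a \<Rightarrow> 'a" where
  "br u v = fst u * snd v - fst v * snd u"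

text \<open>
  The arguments stand for the values at \<open>p - e3\<close>, \<open>p - e1\<close>, \<open>p + e1\<close>, \<open>p + e2\<close>, \<open>p - e2\<close>. The dSKP
  relation says that the value at \<open>p + e3\<close> is proportional to the resulting vector, which vanishes
  exactly when the relation does not determine that value.
\<close>

definition covector ::
    "'a :: comm_ring_1 \<times> 'a \<Rightarrow> 'a \<times> 'a \<Rightarrow> 'a \<times> 'a \<Rightarrow> 'a \<times> 'a \<Rightarrow> 'a \<times> 'a \<Rightarrow> 'a \<times> 'a" where
  "covector b p q s t =
    (br b s * br t q * fst p - br s p * br q b * fst t,
     br b s * br t q * snd p - br s p * br q b * snd t)"

text \<open>The summands have the shape of numerator and denominator of the dSKP quotient, with
  \<open>z\<close> as top value.\<close>

lemma br_covector:
  "br (covector b p q s t) z = br b s * br p z * br t q + br s p * br z t * br q b"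
  by (simp add: covector_def br_def algebra_simps)

text \<open>The hypotheses are the coefficients of \<open>z b = p q - s t\<close> for affine
  polynomials. As \<open>b\<close> divides the right side, their resultant vanishes; eliminating the
  quotient \<open>z\<close> turns \<open>b0^2 * ?G\<close> into a multiple of that
  resultant.\<close>

lemma resultant_condensation:
  fixes b0 :: "'a :: idom"
  assumes "b0 \<noteq> 0"
    and 0: "z0 * b0 = p0 * q0 - s0 * t0"
    and 1: "z0 * b1 + z1 * b0 = p0 * q1 + p1 * q0 - (s0 * t1 + s1 * t0)"
    and 2: "z1 * b1 = p1 * q1 - s1 * t1"
  shows "(b0 * s1 - s0 * b1) * (p0 * z1 - z0 * p1) * (t0 * q1 - q0 * t1)
    + (s0 * p1 - p0 * s1) * (z0 * t1 - t0 * z1) * (q0 * b1 - b0 * q1) = 0"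
    (is "?G = 0")
proof -
  define Q0 where "Q0 = p0 * q0 - s0 * t0"
  define Q1 where "Q1 = p0 * q1 + p1 * q0 - (s0 * t1 + s1 * t0)"
  define Q2 where "Q2 = p1 * q1 - s1 * t1"
  \<comment> \<open>Up to a power of \<open>b1\<close>, this is \<open>Q0 + Q1 u + Q2 u^2\<close> at
    the root of \<open>b0 + b1 u\<close>.\<close>
  have K: "b0^2 * Q2 - b0 * b1 * Q1 + b1^2 * Q0 = 0"
    unfolding Q0_def Q1_def Q2_def 0[symmetric] 1[symmetric] 2[symmetric]
    by (simp add: algebra_simps power2_eq_square)
  have z0: "b0^2 * z0 = b0 * Q0"
    unfolding Q0_def 0[symmetric] by (simp add: algebra_simps power2_eq_square)
  have z1: "b0^2 * z1 = b0 * Q1 - b1 * Q0"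
    unfolding Q0_def Q1_def 0[symmetric] 1[symmetric]
    by (simp add: algebra_simps power2_eq_square)
  have "b0^2 * ?G = (b0 * s1 - s0 * b1) * (p0 * (b0^2 * z1) - (b0^2 * z0) * p1) * (t0 * q1 - q0 * t1)
    + (s0 * p1 - p0 * s1) * ((b0^2 * z0) * t1 - t0 * (b0^2 * z1)) * (q0 * b1 - b0 * q1)"
    by (simp add: algebra_simps)
  also have "\<dots> = (s0 * t0 * (p0 * q1 + p1 * q0) - p0 * q0 * (s0 * t1 + s1 * t0))
      * (b0^2 * Q2 - b0 * b1 * Q1 + b1^2 * Q0)"
    unfolding z0 z1 Q0_def Q1_def Q2_def by (simp add: algebra_simps power2_eq_square)
  finally show ?thesis using assms(1) K by simp
qed

lemma br_covector_condensation:
  fixes b :: "'a :: idom \<times> 'a"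
  assumes "b \<noteq> (0, 0)"
    and 0: "fst z * fst b = fst p * fst q - fst s * fst t"
    and 1: "fst z * snd b + snd z * fst b
      = fst p * snd q + snd p * fst q - (fst s * snd t + snd s * fst t)"
    and 2: "snd z * snd b = snd p * snd q - snd s * snd t"
  shows "br (covector b p q s t) z = 0"
proof (cases "fst b = 0")
  case False
  from resultant_condensation[OF this 0 1 2]
  show ?thesis unfolding br_covector unfolding br_def by simp
next
  case True
  with assms(1) have "snd b \<noteq> 0" by (cases b) auto
  \<comment> \<open>Swapping constant and linear coefficients preserves the hypotheses and only
    changes the sign of each bracket.\<close>
  from resultant_condensation[OF this 2 _ 0] 1
  show ?thesis unfolding br_covector unfolding br_def by (simp add: algebra_simps)
qed

text \<open>Here \<open>p q = s t\<close> as polynomials: if the products are nonzero, the roots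
  agree in pairs and the top value is free. Contrapositively, a nonzero covector forces a nonzero
  \<open>z\<close> in \<open>z b = p q - s t\<close>.\<close>

lemma covector_eq_0:
  fixes p :: "'a :: idom \<times> 'a"
  assumes 0: "fst p * fst q = fst s * fst t"
    and 1: "fst p * snd q + snd p * fst q = fst s * snd t + snd s * fst t"
    and 2: "snd p * snd q = snd s * snd t"
  shows "covector b p q s t = (0, 0)"
proof -
  \<comment> \<open>Pairs with equal sum and product coincide. Applied to the mixed products of
    coefficients, this avoids deciding which factors match.\<close>
  have two_roots: "(A - B) * (C - A) = 0" if "A + D = B + C" "A * D = B * C" for A B C D :: 'a
  proof -
    have "(A - B) * (C - A) = A * (B + C) - A * A - B * C" by (simp add: algebra_simps)
    also have "\<dots> = 0" unfolding that[symmetric] by (simp add: algebra_simps)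
    finally show ?thesis .
  qed
  define e where "e = fst p * snd q - fst s * snd t"
  have e: "e = snd s * fst t - snd p * fst q"
    using 1 by (simp add: e_def algebra_simps)
  have e_s: "e * (snd s * fst t - fst p * snd q) = 0"
    unfolding e_def using arg_cong2[OF 0 2, of "(*)"]
    by (intro two_roots[OF 1]) (simp add: ac_simps)
  have e_p: "e * (snd p * fst q - fst s * snd t) = 0"
    unfolding e mult.commute[of "snd s * fst t - snd p * fst q"]
    using arg_cong2[OF 0 2, of "(*)"] 1
    by (intro two_roots[where D = "fst p * snd q"]) (simp_all add: ac_simps)
  have tq: "br t q * fst p = e * fst t" "br t q * snd p = e * snd t"
    using 0 by (simp add: e_def br_def algebra_simps) (use 2 in \<open>simp add: e br_def algebra_simps\<close>)
  have sp: "br s p * fst t = - (e * fst p)" "br s p * snd t = - (e * snd p)"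
    using 0 by (simp add: e br_def algebra_simps) (use 2 in \<open>simp add: e_def br_def algebra_simps\<close>)
  have "fst (covector b p q s t) = br b s * (br t q * fst p) - br q b * (br s p * fst t)"
    by (simp add: covector_def algebra_simps)
  also have "\<dots> = fst b * (e * (snd s * fst t - fst p * snd q))
      + e * snd b * (fst p * fst q - fst s * fst t)"
    unfolding tq sp by (simp add: br_def algebra_simps)
  finally have "fst (covector b p q s t) = 0" using e_s 0 by simp
  moreover have "snd (covector b p q s t) = br b s * (br t q * snd p) - br q b * (br s p * snd t)"
    by (simp add: covector_def algebra_simps)
  then have "snd (covector b p q s t) = snd b * (e * (snd p * fst q - fst s * snd t))
      + e * fst b * (snd s * snd t - snd p * snd q)"
    unfolding tq sp by (simp add: br_def algebra_simps)
  then have "snd (covector b p q s t) = 0" using e_p 2 by simp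
  ultimately show ?thesis by (simp add: prod_eq_iff)
qed

subsection \<open>Adding a constant to all entries\<close>

text \<open>The coefficients of \<open>det (A + t)\<close>, affine in \<open>t\<close>; the linear
  one is the difference of the values at 1 and 0.\<close>

definition pencil :: "(int \<Rightarrow> int \<Rightarrow> 'a :: comm_ring_1) \<Rightarrow> int \<Rightarrow> int \<Rightarrow> nat \<Rightarrow> 'a \<times> 'a" where
  "pencil A r c n = (det (window A r c n),
     det (window (\<lambda>i j. A i j + 1) r c n) - det (window A r c n))"

text \<open>
  Subtracting the first row from all others confines \<open>u\<close> to the first row.
\<close>

lemma det_window_add_const:
  fixes A :: "int \<Rightarrow> int \<Rightarrow> 'a :: comm_ring_1"
  shows "det (window (\<lambda>i j. A i j + u) r c n) = fst (pencil A r c n) + u * snd (pencil A r c n)"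
proof (cases "n = 0")
  case True
  then show ?thesis by (simp add: pencil_def)
next
  case False
  define L where "L = mat n n (\<lambda>(i, k). if k = i then 1 else if k = 0 then - 1 else 0 :: 'a)"
  define C where "C = (\<lambda>j. cofactor (L * window A r c n) 0 j)"
  have L: "L \<in> carrier_mat n n" by (simp add: L_def)
  have "det L = prod_list (diag_mat L)"
    by (rule det_lower_triangular[OF _ L]) (auto simp: L_def)
  also have "diag_mat L = map (\<lambda>_. 1) [0..<n]"
    by (auto simp: diag_mat_def L_def)
  finally have "det L = 1" by (simp add: map_replicate_const)
  have LW: "(L * window B r c n) $$ (i, j)
      = B (r + int i) (c + int j) - (if i = 0 then 0 else B r (c + int j))"
    if "i < n" "j < n" for B i j
  proof -
    have "(L * window B r c n) $$ (i, j) = (\<Sum>k = 0..<n. L $$ (i, k) * B (r + int k) (c + int j))"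
      using that L by (simp add: scalar_prod_def)
    also have "\<dots> = (\<Sum>k = 0..<n. (if k = i then B (r + int k) (c + int j) else 0)
        - (if k = 0 then if i = 0 then 0 else B r (c + int j) else 0))"
      using that by (intro sum.cong) (auto simp: L_def)
    also have "\<dots> = B (r + int i) (c + int j) - (if i = 0 then 0 else B r (c + int j))"
      using that by (simp add: sum_subtractf)
    finally show ?thesis .
  qed
  have affine: "det (window (\<lambda>i j. A i j + u) r c n) = (\<Sum>j<n. (A r (c + int j) + u) * C j)" for u
  proof -
    let ?B = "\<lambda>i j. A i j + u"
    have "det (window ?B r c n) = det (L * window ?B r c n)"
      using det_mult[OF L window_carrier] \<open>det L = 1\<close> by simp
    also have "\<dots> = (\<Sum>j<n. (L * window ?B r c n) $$ (0, j) * cofactor (L * window ?B r c n) 0 j)"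
      using L False by (intro laplace_expansion_row) auto
    also have "\<dots> = (\<Sum>j<n. (A r (c + int j) + u) * C j)"
    proof (intro sum.cong refl)
      fix j assume "j \<in> {..<n}"
      \<comment> \<open>Only the deleted row contains \<open>u\<close>, so the cofactors do not
        depend on it.\<close>
      have "mat_delete (L * window ?B r c n) 0 j = mat_delete (L * window A r c n) 0 j"
        using LW L by (intro eq_matI) (auto simp: mat_delete_def)
      with False \<open>j \<in> {..<n}\<close> show "(L * window ?B r c n) $$ (0, j) * cofactor (L * window ?B r c n) 0 j
          = (A r (c + int j) + u) * C j"
        by (simp add: LW C_def cofactor_def)
    qed
    finally show ?thesis .
  qed
  show ?thesis
    unfolding pencil_def fst_conv snd_conv using affine[of u] affine[of 1] affine[of 0]
    by (simp add: algebra_simps sum.distrib sum_distrib_left)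
qed

text \<open>Condensation for \<open>A + u\<close> is an identity of quadratic polynomials in
  \<open>u\<close>; its values at 0, 1 and -1 isolate the coefficients, characteristic 0 permitting
  division by 2.\<close>

lemma pencil_condensation:
  fixes A :: "int \<Rightarrow> int \<Rightarrow> 'a :: {idom, ring_char_0}" and r c n
  defines "z \<equiv> pencil A r c (n + 2)" and "b \<equiv> pencil A (r + 1) (c + 1) n"
    and "p \<equiv> pencil A r c (n + 1)" and "q \<equiv> pencil A (r + 1) (c + 1) (n + 1)"
    and "s \<equiv> pencil A (r + 1) c (n + 1)" and "t \<equiv> pencil A r (c + 1) (n + 1)"
  shows "fst z * fst b = fst p * fst q - fst s * fst t"
    and "fst z * snd b + snd z * fst b
      = fst p * snd q + snd p * fst q - (fst s * snd t + snd s * fst t)"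
    and "snd z * snd b = snd p * snd q - snd s * snd t"
proof -
  have D: "(fst z + u * snd z) * (fst b + u * snd b)
      = (fst p + u * snd p) * (fst q + u * snd q) - (fst s + u * snd s) * (fst t + u * snd t)" for u
    using Dodgson_condensation[of "\<lambda>i j. A i j + u" r c n]
    unfolding det_window_add_const z_def b_def p_def q_def s_def t_def .
  show 0: "fst z * fst b = fst p * fst q - fst s * fst t"
    using D[of 0] by simp
  have "2 * (snd z * snd b) = (fst z + 1 * snd z) * (fst b + 1 * snd b)
      + (fst z + (- 1) * snd z) * (fst b + (- 1) * snd b) - 2 * (fst z * fst b)"
    by (simp add: algebra_simps)
  also have "\<dots> = 2 * (snd p * snd q - snd s * snd t)"
    unfolding D 0 by (simp add: algebra_simps)
  finally have "2 * (snd z * snd b) = 2 * (snd p * snd q - snd s * snd t)" .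
  then show 2: "snd z * snd b = snd p * snd q - snd s * snd t"
    by (subst (asm) mult_cancel_left) simp
  show "fst z * snd b + snd z * fst b
      = fst p * snd q + snd p * fst q - (fst s * snd t + snd s * fst t)"
  proof -
    have "fst z * snd b + snd z * fst b = (fst z + 1 * snd z) * (fst b + 1 * snd b)
        - fst z * fst b - snd z * snd b"
      by (simp add: algebra_simps)
    then show ?thesis unfolding D 0 2 by (simp add: algebra_simps)
  qed
qed

subsection \<open>Projective limits\<close>

text \<open>For nonzero \<open>u\<close>, convergence in the projective line, expressed by rescaling
  representatives.\<close>

definition proj_lim :: "(nat \<Rightarrow> complex \<times> complex) \<Rightarrow> complex \<times> complex \<Rightarrow> bool" where
  "proj_lim V u \<longleftrightarrow> (\<exists>l. (\<forall>\<^sub>F n in sequentially. l n \<noteq> 0) \<and>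
     (\<lambda>n. l n * fst (V n)) \<longlonglongrightarrow> fst u \<and> (\<lambda>n. l n * snd (V n)) \<longlonglongrightarrow> snd u)"

lemma proj_lim_const: "proj_lim (\<lambda>_. u) u"
  unfolding proj_lim_def by (intro exI[of _ "\<lambda>_. 1"]) auto

lemma br_proj_lim_eq_0:
  assumes "proj_lim V u" "proj_lim V' u'" "\<And>n. br (V n) (V' n) = 0"
  shows "br u u' = 0"
proof -
  obtain l where l: "(\<lambda>n. l n * fst (V n)) \<longlonglongrightarrow> fst u" "(\<lambda>n. l n * snd (V n)) \<longlonglongrightarrow> snd u"
    using assms(1) by (auto simp: proj_lim_def)
  obtain l' where l': "(\<lambda>n. l' n * fst (V' n)) \<longlonglongrightarrow> fst u'" "(\<lambda>n. l' n * snd (V' n)) \<longlonglongrightarrow> snd u'"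
    using assms(2) by (auto simp: proj_lim_def)
  have "(\<lambda>n. l n * fst (V n) * (l' n * snd (V' n)) - l' n * fst (V' n) * (l n * snd (V n)))
      \<longlonglongrightarrow> br u u'"
    unfolding br_def by (intro tendsto_intros l l')
  moreover have "l n * fst (V n) * (l' n * snd (V' n)) - l' n * fst (V' n) * (l n * snd (V n))
      = l n * l' n * br (V n) (V' n)" for n
    by (simp add: br_def algebra_simps)
  ultimately have "(\<lambda>n. 0) \<longlonglongrightarrow> br u u'" using assms(3) by simp
  then show ?thesis by (simp add: LIMSEQ_const_iff)
qed

lemma eventually_nonzero:
  fixes V :: "nat \<Rightarrow> complex \<times> complex"
  assumes "(\<lambda>n. k n * fst (V n)) \<longlonglongrightarrow> fst u" "(\<lambda>n. k n * snd (V n)) \<longlonglongrightarrow> snd u" "u \<noteq> (0, 0)"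
  shows "\<forall>\<^sub>F n in sequentially. V n \<noteq> (0, 0)"
proof (cases "fst u = 0")
  case True
  with assms(3) have "snd u \<noteq> 0" by (cases u) auto
  from tendsto_imp_eventually_ne[OF assms(2) this] show ?thesis
    by eventually_elim auto
next
  case False
  from tendsto_imp_eventually_ne[OF assms(1) this] show ?thesis
    by eventually_elim auto
qed

lemma br_eq_0_imp_multiple:
  fixes u v :: "'a :: field \<times> 'a"
  assumes "br u v = 0" "u \<noteq> (0, 0)" "v \<noteq> (0, 0)"
  obtains c where "c \<noteq> 0" "fst v = c * fst u" "snd v = c * snd u"
proof (cases "fst u = 0")
  case True
  with assms(2) have "snd u \<noteq> 0" by (cases u) auto
  with True assms have "fst v = 0" "snd v \<noteq> 0" by (cases v; auto simp: br_def)+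
  with True \<open>snd u \<noteq> 0\<close> show ?thesis by (intro that[of "snd v / snd u"]) auto
next
  case False
  have "fst v \<noteq> 0"
    using assms(1,3) False by (cases v) (auto simp: br_def)
  with False assms show ?thesis
    by (intro that[of "fst v / fst u"]) (auto simp: br_def field_simps)
qed

text \<open>The covectors converge projectively to a nonzero limit proportional to
  \<open>uz\<close>, and eventually \<open>z n\<close> is a nonzero multiple of the covector at
  \<open>n\<close>.\<close>

lemma proj_lim_condensation:
  fixes z b p q s t :: "nat \<Rightarrow> complex \<times> complex"
  assumes lims: "proj_lim b ub" "proj_lim p up" "proj_lim q uq" "proj_lim s us" "proj_lim t ut"
    and nz: "ub \<noteq> (0, 0)" "uz \<noteq> (0, 0)" "covector ub up uq us ut \<noteq> (0, 0)"
    and uz: "br (covector ub up uq us ut) uz = 0"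
    and 0: "\<And>n. fst (z n) * fst (b n) = fst (p n) * fst (q n) - fst (s n) * fst (t n)"
    and 1: "\<And>n. fst (z n) * snd (b n) + snd (z n) * fst (b n)
      = fst (p n) * snd (q n) + snd (p n) * fst (q n) - (fst (s n) * snd (t n) + snd (s n) * fst (t n))"
    and 2: "\<And>n. snd (z n) * snd (b n) = snd (p n) * snd (q n) - snd (s n) * snd (t n)"
  shows "proj_lim z uz"
proof -
  obtain lb where lb: "\<forall>\<^sub>F n in sequentially. lb n \<noteq> 0"
      "(\<lambda>n. lb n * fst (b n)) \<longlonglongrightarrow> fst ub" "(\<lambda>n. lb n * snd (b n)) \<longlonglongrightarrow> snd ub"
    using lims(1) by (auto simp: proj_lim_def)
  obtain lp where lp: "\<forall>\<^sub>F n in sequentially. lp n \<noteq> 0"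
      "(\<lambda>n. lp n * fst (p n)) \<longlonglongrightarrow> fst up" "(\<lambda>n. lp n * snd (p n)) \<longlonglongrightarrow> snd up"
    using lims(2) by (auto simp: proj_lim_def)
  obtain lq where lq: "\<forall>\<^sub>F n in sequentially. lq n \<noteq> 0"
      "(\<lambda>n. lq n * fst (q n)) \<longlonglongrightarrow> fst uq" "(\<lambda>n. lq n * snd (q n)) \<longlonglongrightarrow> snd uq"
    using lims(3) by (auto simp: proj_lim_def)
  obtain ls where ls: "\<forall>\<^sub>F n in sequentially. ls n \<noteq> 0"
      "(\<lambda>n. ls n * fst (s n)) \<longlonglongrightarrow> fst us" "(\<lambda>n. ls n * snd (s n)) \<longlonglongrightarrow> snd us"
    using lims(4) by (auto simp: proj_lim_def)
  obtain lt where lt: "\<forall>\<^sub>F n in sequentially. lt n \<noteq> 0"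
      "(\<lambda>n. lt n * fst (t n)) \<longlonglongrightarrow> fst ut" "(\<lambda>n. lt n * snd (t n)) \<longlonglongrightarrow> snd ut"
    using lims(5) by (auto simp: proj_lim_def)
  define W where "W = covector ub up uq us ut"
  define w where "w n = covector (b n) (p n) (q n) (s n) (t n)" for n
  \<comment> \<open>The covector is linear in each of its five arguments, so rescaling them
    multiplies it by this product.\<close>
  define k where "k n = lb n * lp n * lq n * ls n * lt n" for n
  define w' where "w' n = covector (lb n * fst (b n), lb n * snd (b n))
    (lp n * fst (p n), lp n * snd (p n)) (lq n * fst (q n), lq n * snd (q n))
    (ls n * fst (s n), ls n * snd (s n)) (lt n * fst (t n), lt n * snd (t n))" for n
  have w': "fst (w' n) = k n * fst (w n)" "snd (w' n) = k n * snd (w n)" for n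
    by (simp_all add: w'_def w_def k_def covector_def br_def algebra_simps)
  have "(\<lambda>n. fst (w' n)) \<longlonglongrightarrow> fst W" "(\<lambda>n. snd (w' n)) \<longlonglongrightarrow> snd W"
    unfolding w'_def W_def covector_def br_def fst_conv snd_conv
    by (intro tendsto_intros lb lp lq ls lt)+
  then have w_lim: "(\<lambda>n. k n * fst (w n)) \<longlonglongrightarrow> fst W" "(\<lambda>n. k n * snd (w n)) \<longlonglongrightarrow> snd W"
    by (simp_all add: w')
  have W: "W \<noteq> (0, 0)" using nz by (simp add: W_def)
  obtain \<mu> where \<mu>: "\<mu> \<noteq> 0" "fst uz = \<mu> * fst W" "snd uz = \<mu> * snd W"
    using br_eq_0_imp_multiple[OF _ W nz(2)] uz by (metis W_def)
  have "\<forall>\<^sub>F n in sequentially. w n \<noteq> (0, 0)"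
    by (rule eventually_nonzero[OF w_lim W])
  moreover have "\<forall>\<^sub>F n in sequentially. b n \<noteq> (0, 0)"
    by (rule eventually_nonzero[OF lb(2,3) nz(1)])
  ultimately have "\<forall>\<^sub>F n in sequentially.
    \<exists>c. c \<noteq> 0 \<and> fst (z n) = c * fst (w n) \<and> snd (z n) = c * snd (w n)"
  proof eventually_elim
    case (elim n)
    have "z n \<noteq> (0, 0)"
    proof
      assume "z n = (0, 0)"
      with 0[of n] 1[of n] 2[of n] have "w n = (0, 0)"
        unfolding w_def by (intro covector_eq_0) auto
      with elim show False by simp
    qed
    moreover have "br (w n) (z n) = 0"
      unfolding w_def by (rule br_covector_condensation[OF elim(2) 0 1 2])
    ultimately show ?case using elim(1) br_eq_0_imp_multiple by metis
  qed
  then obtain c where c: "\<forall>\<^sub>F n in sequentially.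
      c n \<noteq> 0 \<and> fst (z n) = c n * fst (w n) \<and> snd (z n) = c n * snd (w n)"
    unfolding eventually_ex by blast
  \<comment> \<open>The scalar divides out \<open>c n\<close>, rescales the covector by
    \<open>k n\<close>, and carries its limit \<open>W\<close> to \<open>uz\<close>.\<close>
  have "\<forall>\<^sub>F n in sequentially. \<mu> * k n / c n \<noteq> 0"
    using c lb(1) lp(1) lq(1) ls(1) lt(1) by eventually_elim (simp add: \<mu>(1) k_def)
  moreover have "(\<lambda>n. \<mu> * k n / c n * fst (z n)) \<longlonglongrightarrow> fst uz"
  proof (rule Lim_transform_eventually)
    show "(\<lambda>n. \<mu> * (k n * fst (w n))) \<longlonglongrightarrow> fst uz"
      unfolding \<mu> by (intro tendsto_intros w_lim)
    show "\<forall>\<^sub>F n in sequentially. \<mu> * (k n * fst (w n)) = \<mu> * k n / c n * fst (z n)"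
      using c by eventually_elim simp
  qed
  moreover have "(\<lambda>n. \<mu> * k n / c n * snd (z n)) \<longlonglongrightarrow> snd uz"
  proof (rule Lim_transform_eventually)
    show "(\<lambda>n. \<mu> * (k n * snd (w n))) \<longlonglongrightarrow> snd uz"
      unfolding \<mu> by (intro tendsto_intros w_lim)
    show "\<forall>\<^sub>F n in sequentially. \<mu> * (k n * snd (w n)) = \<mu> * k n / c n * snd (z n)"
      using c by eventually_elim simp
  qed
  ultimately show ?thesis
    unfolding proj_lim_def by (intro exI[of _ "\<lambda>n. \<mu> * k n / c n"]) simp
qed

subsection \<open>Propagation of Dodgson initial data\<close>

text \<open>For finite \<open>d = Fin w\<close> this is the Moebius map
  \<open>v -> 1 / (v - w)\<close>, which moves \<open>d\<close> to infinity.\<close>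

fun coord :: "riemann_sphere \<Rightarrow> riemann_sphere \<Rightarrow> complex \<times> complex" where
  "coord (Fin w) v = (hden v, hnum v - w * hden v)"
| "coord Infty v = (hnum v, hden v)"

lemma coord_self: "coord d d = (1, 0)"
  by (cases d) auto

lemma coord_nonzero: "coord d v \<noteq> (0, 0)"
  by (cases d; cases v) auto

text \<open>The coordinate change is linear of determinant 1 or -1.\<close>

lemma br_coord: "\<exists>e. e * e = 1 \<and> (\<forall>u v. br (coord d u) (coord d v) = e * hdiff u v)"
proof (cases d)
  case (Fin w)
  then show ?thesis by (intro exI[of _ "-1"]) (auto simp: br_def hdiff_def algebra_simps)
next
  case Infty
  then show ?thesis by (intro exI[of _ 1]) (auto simp: br_def hdiff_def)
qed

lemma br_coord_eq_0_iff: "br (coord d u) (coord d v) = 0 \<longleftrightarrow> u = v"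
  using br_coord[of d] by (metis hdiff_eq_0_iff mult_eq_0_iff zero_neq_one)

definition skp_covector ::
    "riemann_sphere \<Rightarrow> (point \<Rightarrow> riemann_sphere) \<Rightarrow> point \<Rightarrow> complex \<times> complex" where
  "skp_covector d x p = covector (coord d (x (p - e3))) (coord d (x (p - e1)))
     (coord d (x (p + e1))) (coord d (x (p + e2))) (coord d (x (p - e2)))"

lemma dSKP_at_iff: "dSKP_at x p \<longleftrightarrow> br (skp_covector d x p) (coord d (x (p + e3))) = 0"
proof -
  obtain e where e: "e * e = 1" "\<And>u v. br (coord d u) (coord d v) = e * hdiff u v"
    using br_coord[of d] by blast
  have "br (skp_covector d x p) (coord d (x (p + e3))) = e * (e * e) * (skp_num x p + skp_den x p)"
    by (simp add: skp_covector_def br_covector e(2) skp_num_def skp_den_def algebra_simps)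
  moreover have "e \<noteq> 0" using e(1) by auto
  ultimately show ?thesis by (simp add: dSKP_at_def eq_neg_iff_add_eq_0)
qed

text \<open>With a zero covector every top value would solve the relation, against
  uniqueness.\<close>

lemma skp_covector_nonzero:
  assumes "determines_top x p"
  shows "skp_covector d x p \<noteq> (0, 0)"
proof
  assume 0: "skp_covector d x p = (0, 0)"
  have "dSKP_at (x(p + e3 := y)) p" for y
  proof -
    have "skp_covector d (x(p + e3 := y)) p = skp_covector d x p"
      by (cases p) (simp add: skp_covector_def e1_def e2_def e3_def)
    then show ?thesis by (simp add: dSKP_at_iff[where d = d] 0 br_def)
  qed
  with assms show False
    unfolding determines_top_def by (metis riemann_sphere.distinct(1))
qed

text \<open>By periodicity a shift permutes rows or columns cyclically. Adding 1 to all entries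
  preserves the period, so both coefficients change by the same sign.\<close>

lemma br_pencil_shift:
  fixes A :: "int \<Rightarrow> int \<Rightarrow> 'a :: idom"
  assumes "\<And>i j. A (i + int n) j = A i j" "\<And>i j. A i (j + int n) = A i j"
  shows "br (pencil A r c n) (pencil A (r + 1) c n) = 0"
    and "br (pencil A r c n) (pencil A r (c + 1) n) = 0"
proof -
  have row: "det (window B r c n) = (-1) ^ (n - 1) * det (window B (r + 1) c n)"
    if "\<And>i j. B (i + int n) j = B i j" for B :: "int \<Rightarrow> int \<Rightarrow> 'a"
  proof (cases n)
    case (Suc k)
    \<comment> \<open>The first row moves below the other \<open>k\<close> rows, where periodicity
      identifies it with row \<open>r + int n\<close>.\<close>
    have "det (window B r c n) = (-1) ^ (k * 1) * det (mat (k + 1) (k + 1)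
        (\<lambda>(i, j). window B r c n $$ (if i < k then i + 1 else i - k, j)))"
      by (rule det_swap_rows) (simp add: Suc)
    also have "mat (k + 1) (k + 1) (\<lambda>(i, j). window B r c n $$ (if i < k then i + 1 else i - k, j))
        = window B (r + 1) c n"
    proof (rule eq_matI)
      fix i j assume "i < dim_row (window B (r + 1) c n)" "j < dim_col (window B (r + 1) c n)"
      then have "i \<le> k" "j \<le> k" by (auto simp: Suc)
      then show "mat (k + 1) (k + 1) (\<lambda>(i, j). window B r c n $$ (if i < k then i + 1 else i - k, j)) $$ (i, j)
          = window B (r + 1) c n $$ (i, j)"
        using that[of r "c + int j"] by (auto simp: Suc algebra_simps not_less)
    qed (simp_all add: Suc)
    finally show ?thesis by (simp add: Suc)
  qed (simp add: window_def)
  have col: "det (window B r c n) = (-1) ^ (n - 1) * det (window B r (c + 1) n)"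
    if "\<And>i j. B i (j + int n) = B i j" for B :: "int \<Rightarrow> int \<Rightarrow> 'a"
  proof (cases n)
    case (Suc k)
    have "det (window B r c n) = (-1) ^ (k * 1) * det (mat (k + 1) (k + 1)
        (\<lambda>(i, j). window B r c n $$ (i, if j < k then j + 1 else j - k)))"
      by (rule det_swap_cols) (simp add: Suc)
    also have "mat (k + 1) (k + 1) (\<lambda>(i, j). window B r c n $$ (i, if j < k then j + 1 else j - k))
        = window B r (c + 1) n"
    proof (rule eq_matI)
      fix i j assume "i < dim_row (window B r (c + 1) n)" "j < dim_col (window B r (c + 1) n)"
      then have "i \<le> k" "j \<le> k" by (auto simp: Suc)
      then show "mat (k + 1) (k + 1) (\<lambda>(i, j). window B r c n $$ (i, if j < k then j + 1 else j - k)) $$ (i, j)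
          = window B r (c + 1) n $$ (i, j)"
        using that[of "r + int i" c] by (auto simp: Suc algebra_simps not_less)
    qed (simp_all add: Suc)
    finally show ?thesis by (simp add: Suc)
  qed (simp add: window_def)
  show "br (pencil A r c n) (pencil A (r + 1) c n) = 0"
    using row[of A] row[of "\<lambda>i j. A i j + 1"] assms
    by (simp add: pencil_def br_def algebra_simps)
  show "br (pencil A r c n) (pencil A r (c + 1) n) = 0"
    using col[of A] col[of "\<lambda>i j. A i j + 1"] assms
    by (simp add: pencil_def br_def algebra_simps)
qed

lemma int_shift_invariant_const:
  fixes f :: "int \<Rightarrow> 'a"
  assumes "\<And>r. f (r + 1) = f r"
  shows "f r = f 0"
proof (induction r rule: int_induct[where k = 0])
  case (step1 i)
  then show ?case using assms[of i] by simp
next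
  case (step2 i)
  then show ?case using assms[of "i - 1"] by simp
qed simp

text \<open>
  The top of the pyramid over the \<open>n \<times> n\<close> block of height-1 sites with upper left corner \<open>(r, c)\<close>.
\<close>

definition site :: "int \<Rightarrow> int \<Rightarrow> nat \<Rightarrow> point" where
  "site r c n = (r + c + int n, r - c, int n)"

text \<open>\<open>snd u = 0\<close> means that the height-1 value is \<open>d\<close>. The entry
  depends only on that value and \<open>N\<close>, so the perturbed matrix keeps the periods of the
  data.\<close>

definition approx_entry ::
    "riemann_sphere \<Rightarrow> (point \<Rightarrow> riemann_sphere) \<Rightarrow> nat \<Rightarrow> int \<Rightarrow> int \<Rightarrow> complex" where
  "approx_entry d x N r c = (let u = coord d (x (site r c 1)) in
     if snd u = 0 then of_nat N else fst u / snd u)"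

lemma proj_lim_approx_entry:
  "proj_lim (\<lambda>N. (approx_entry d x N r c, 1)) (coord d (x (site r c 1)))"
proof -
  obtain a b where ab: "coord d (x (site r c 1)) = (a, b)" by (cases "coord d (x (site r c 1))")
  show ?thesis
  proof (cases "b = 0")
    case True
    with ab coord_nonzero[of d "x (site r c 1)"] have "a \<noteq> 0" by auto
    \<comment> \<open>These scalars turn \<open>(of_nat N, 1)\<close> into
      \<open>(a, a / of_nat N)\<close> for positive \<open>N\<close>, with limit
      \<open>(a, 0)\<close>.\<close>
    have "\<forall>\<^sub>F N in sequentially. a / of_nat N \<noteq> 0"
      using eventually_gt_at_top[of 0] by eventually_elim (simp add: \<open>a \<noteq> 0\<close>)
    moreover have "(\<lambda>N. a / of_nat N * of_nat N) \<longlonglongrightarrow> a"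
      by (rule tendsto_eventually, rule eventually_mono[OF eventually_gt_at_top[of 0]]) simp
    moreover have "(\<lambda>N. a / of_nat N) \<longlonglongrightarrow> 0" by (rule lim_const_over_n)
    ultimately show ?thesis
      unfolding proj_lim_def approx_entry_def ab
      by (intro exI[of _ "\<lambda>N. a / of_nat N"]) (simp add: True)
  next
    case False
    then show ?thesis
      unfolding proj_lim_def approx_entry_def ab by (intro exI[of _ "\<lambda>_. b"]) simp
  qed
qed

text \<open>Induction on the height: two consecutive levels yield the next by condensation, unique
  solvability making the limiting covector nonzero.\<close>

lemma proj_lim_pencil:
  assumes "dSKP x" "propagates_up_to m x" and base: "\<And>r c. x (site r c 0) = d"
  shows "int n \<le> m \<Longrightarrow> proj_lim (\<lambda>N. pencil (approx_entry d x N) r c n) (coord d (x (site r c n)))"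
proof (induction n arbitrary: r c rule: induct_nat_012)
  case 0
  have "pencil (approx_entry d x N) r c 0 = coord d d" for N
    by (simp add: pencil_def window_def coord_self)
  then show ?case by (simp add: base proj_lim_const)
next
  case 1
  have "det (window B r c (Suc 0)) = B r c" for B :: "int \<Rightarrow> int \<Rightarrow> complex"
    using det_single[of "window B r c 1"] by simp
  then have "pencil (approx_entry d x N) r c (Suc 0) = (approx_entry d x N r c, 1)" for N
    by (simp add: pencil_def)
  then show ?case using proj_lim_approx_entry by simp
next
  case (ge2 n)
  \<comment> \<open>The centre of the octahedron with top \<open>site r c (n + 2)\<close>; its
    horizontal neighbours are the tops over the four corner blocks of size
    \<open>n + 1\<close>.\<close>
  define p :: point where "p = (r + c + int n + 2, r - c, int n + 1)"
  have sites: "p + e3 = site r c (Suc (Suc n))" "p - e3 = site (r + 1) (c + 1) n"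
      "p - e1 = site r c (Suc n)" "p + e1 = site (r + 1) (c + 1) (Suc n)"
      "p + e2 = site (r + 1) c (Suc n)" "p - e2 = site r (c + 1) (Suc n)"
    by (simp_all add: p_def site_def e1_def e2_def e3_def)
  have "p \<notin> lattice" by (auto simp: p_def lattice_def)
  with assms(1,2) ge2.prems have "dSKP_at x p" "determines_top x p"
    by (auto simp: dSKP_def propagates_up_to_def p_def)
  then have br: "br (skp_covector d x p) (coord d (x (p + e3))) = 0"
    and nz: "skp_covector d x p \<noteq> (0, 0)"
    using dSKP_at_iff skp_covector_nonzero by blast+
  show ?case
  proof (rule proj_lim_condensation)
    show "proj_lim (\<lambda>N. pencil (approx_entry d x N) (r + 1) (c + 1) n) (coord d (x (p - e3)))"
      "proj_lim (\<lambda>N. pencil (approx_entry d x N) r c (Suc n)) (coord d (x (p - e1)))"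
      "proj_lim (\<lambda>N. pencil (approx_entry d x N) (r + 1) (c + 1) (Suc n)) (coord d (x (p + e1)))"
      "proj_lim (\<lambda>N. pencil (approx_entry d x N) (r + 1) c (Suc n)) (coord d (x (p + e2)))"
      "proj_lim (\<lambda>N. pencil (approx_entry d x N) r (c + 1) (Suc n)) (coord d (x (p - e2)))"
      unfolding sites using ge2 by auto
    show "covector (coord d (x (p - e3))) (coord d (x (p - e1))) (coord d (x (p + e1)))
        (coord d (x (p + e2))) (coord d (x (p - e2))) \<noteq> (0, 0)"
      using nz unfolding skp_covector_def .
    show "br (covector (coord d (x (p - e3))) (coord d (x (p - e1))) (coord d (x (p + e1)))
        (coord d (x (p + e2))) (coord d (x (p - e2)))) (coord d (x (site r c (Suc (Suc n))))) = 0"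
      using br unfolding skp_covector_def sites(1) .
  qed (use coord_nonzero pencil_condensation[of "approx_entry d x _" r c n] in simp_all)
qed

theorem theorem1p4:
  fixes m :: int and x :: "point \<Rightarrow> riemann_sphere"
  assumes "m \<ge> 1"
    and "dSKP x"
    and "propagates_up_to m x"
    and "Dodgson m (initial_data x)"
  shows "\<forall>i j i' j'. (i, j, m) \<in> lattice \<longrightarrow> (i', j', m) \<in> lattice \<longrightarrow> x (i, j, m) = x (i', j', m)"
proof -
  define M where "M = nat m"
  have M: "int M = m" using assms(1) by (simp add: M_def)
  obtain d where d: "\<And>i j. even (i + j) \<Longrightarrow> initial_data x i j = d"
    and per: "\<And>i j. odd (i + j) \<Longrightarrow> initial_data x i j = initial_data x (i + m) (j + m)"
      "\<And>i j. odd (i + j) \<Longrightarrow> initial_data x i j = initial_data x (i + m) (j - m)"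
    using assms(4) unfolding Dodgson_def by blast
  let ?A = "approx_entry d x"
  have site0: "x (site r c 0) = d" for r c
    using d[of "r + c" "r - c"] by (simp add: site_def initial_data_def)
  have site1: "x (site r c 1) = initial_data x (r + c + 1) (r - c)" for r c
  proof -
    have "(r + c + 1 + (r - c)) mod 2 = 1" by presburger
    then show ?thesis by (simp add: site_def initial_data_def)
  qed
  \<comment> \<open>Shifting the row index by \<open>m\<close> is the period \<open>(m, m)\<close>
    of the plane, shifting the column index the period \<open>(m, -m)\<close>.\<close>
  have "x (site (r + m) c 1) = x (site r c 1)" "x (site r (c + m) 1) = x (site r c 1)" for r c
    using per[of "r + c + 1" "r - c"] unfolding site1 by (simp_all add: algebra_simps)
  then have A: "?A N (r + int M) c = ?A N r c" "?A N r (c + int M) = ?A N r c" for N r c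
    by (simp_all only: approx_entry_def M)
  have lim: "proj_lim (\<lambda>N. pencil (?A N) r c M) (coord d (x (site r c M)))" for r c
    by (rule proj_lim_pencil[OF assms(2,3) site0]) (simp add: M)
  have "x (site (r + 1) c M) = x (site r c M)" for r c
  proof -
    have "br (pencil (?A N) r c M) (pencil (?A N) (r + 1) c M) = 0" for N
      by (rule br_pencil_shift(1)) (rule A)+
    from br_proj_lim_eq_0[OF lim lim this] show ?thesis by (simp add: br_coord_eq_0_iff)
  qed
  moreover have "x (site r (c + 1) M) = x (site r c M)" for r c
  proof -
    have "br (pencil (?A N) r c M) (pencil (?A N) r (c + 1) M) = 0" for N
      by (rule br_pencil_shift(2)) (rule A)+
    from br_proj_lim_eq_0[OF lim lim this] show ?thesis by (simp add: br_coord_eq_0_iff)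
  qed
  ultimately have const: "x (site r c M) = x (site 0 0 M)" for r c
    using int_shift_invariant_const[of "\<lambda>r. x (site r c M)" r]
      int_shift_invariant_const[of "\<lambda>c. x (site 0 c M)" c] by simp
  have "x (i, j, m) = x (site 0 0 M)" if "(i, j, m) \<in> lattice" for i j
  proof -
    have "even (i + j + m)" using that by (simp add: lattice_def)
    \<comment> \<open>Solves \<open>i = r + c + m\<close> and \<open>j = r - c\<close>; parity makes
      both divisions exact.\<close>
    then have "(i, j, m) = site ((i + j - m) div 2) ((i - j - m) div 2) M"
      unfolding site_def M by (simp add: prod_eq_iff) presburger
    then show ?thesis using const by simp
  qed
  then show ?thesis by simp
qed

end
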